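(* Let $p\ge2$ and $q\ge1$ be coprime integers, let $R>r>0$, and consider the plane curve $$x(t)=[R+r\cos(qt)]\cos(pt),\qquad y(t)=[R+r\cos(qt)]\sin(pt),\qquad t\in\mathbb{R}.$$ For $1\le k\le p-1$, $0\le j\le q-1$ put $t_{k,j}=\frac{k\pi}{p}+\frac{j\pi}{q}$. Then the points $$M_{k,j}=\big(x(t_{k,j}),y(t_{k,j})\big),\qquad 1\le k\le p-1,\quad 0\le j\le q-1,$$ are self-intersection points of the curve.
   Context: A plane curve $(x(t),y(t))$ has a self-intersection at a point $(x_0,y_0)$ if it has different tangent lines at this point, i.e. there are parameter values $t,\tau$ with $(x(t),y(t))=(x(\tau),y(\tau))=(x_0,y_0)$ and $\dot y(t)/\dot x(t)\neq\dot y(\tau)/\dot x(\tau)$ (slope $\infty$ allowed when $\dot x=0\neq\dot y$). *)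

theory Defs
  imports Complex_Main "HOL-Library.Extended_Real"
begin

text \<open>
  The value \<open>\<infinity>\<close> is the slope of a vertical tangent, i.e. \<open>x' = 0 \<noteq> y'\<close>; parameter values with
  \<open>x' = y' = 0\<close> have no tangent slope. \<open>-\<infinity>\<close> never occurs, so distinct slopes
  correspond to distinct tangent directions.
\<close>
definition has_tangent_slope :: "(real \<Rightarrow> real) \<Rightarrow> (real \<Rightarrow> real) \<Rightarrow> real \<Rightarrow> ereal \<Rightarrow> bool" where
  "has_tangent_slope x y t m \<longleftrightarrow>
     (\<exists>x' y'. (x has_real_derivative x') (at t) \<and> (y has_real_derivative y') (at t) \<and>
        (x' \<noteq> 0 \<and> m = ereal (y' / x') \<or> x' = 0 \<and> y' \<noteq> 0 \<and> m = \<infinity>))"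

definition self_intersection_point :: "(real \<Rightarrow> real) \<Rightarrow> (real \<Rightarrow> real) \<Rightarrow> real \<times> real \<Rightarrow> bool" where
  "self_intersection_point x y P \<longleftrightarrow>
     (\<exists>t \<tau> m n. (x t, y t) = P \<and> (x \<tau>, y \<tau>) = P \<and>
        has_tangent_slope x y t m \<and> has_tangent_slope x y \<tau> n \<and> m \<noteq> n)"

definition curve_x :: "real \<Rightarrow> real \<Rightarrow> int \<Rightarrow> int \<Rightarrow> real \<Rightarrow> real" where
  "curve_x R r p q t = (R + r * cos (of_int q * t)) * cos (of_int p * t)"

definition curve_y :: "real \<Rightarrow> real \<Rightarrow> int \<Rightarrow> int \<Rightarrow> real \<Rightarrow> real" where
  "curve_y R r p q t = (R + r * cos (of_int q * t)) * sin (of_int p * t)"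

definition crossing_param :: "int \<Rightarrow> int \<Rightarrow> int \<Rightarrow> int \<Rightarrow> real" where
  "crossing_param p q k j = of_int k * pi / of_int p + of_int j * pi / of_int q"

end

theory Submission
  imports Defs
begin

text \<open>
  In polar coordinates the curve has radius \<open>R + r cos (q t) > 0\<close> and angle \<open>p t\<close>.
  Reflecting \<open>t = k \<pi> / p + j \<pi> / q\<close> about \<open>j \<pi> / q\<close> gives the second parameter
  \<open>\<tau> = - k \<pi> / p + j \<pi> / q\<close> of the crossing. The radius is unchanged, because
  \<open>j \<pi> / q\<close> is a critical point of \<open>cos (q t)\<close> and hence a symmetry centre of the radius,
  and the angle changes by \<open>2 k \<pi>\<close>; so both parameters give the same point.

  The two velocities at this point have the same angular component, which is positive, and
  opposite radial components \<open>\<plusminus> q r sin (q t)\<close>. They are therefore linearly independent as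
  soon as \<open>sin (q t) \<noteq> 0\<close>. Up to sign this sine is \<open>sin (q k \<pi> / p)\<close>, which could only vanish
  if \<open>p\<close> divided \<open>q k\<close>; coprimality would then force \<open>p\<close> to divide \<open>k\<close>, contradicting
  \<open>0 < k < p\<close>.
\<close>

text \<open>
  Working with the determinant of the two velocities avoids a case distinction in the
  application on whether one of the two tangents is vertical.
\<close>
lemma self_intersection_point_if_independent_velocities:
  assumes "x t = x \<tau>" "y t = y \<tau>"
    and "(x has_real_derivative x1) (at t)" "(y has_real_derivative y1) (at t)"
    and "(x has_real_derivative x2) (at \<tau>)" "(y has_real_derivative y2) (at \<tau>)"
    and det: "x1 * y2 \<noteq> x2 * y1"
  shows "self_intersection_point x y (x t, y t)"
proof -
  define m where "m = (if x1 = 0 then \<infinity> else ereal (y1 / x1))"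
  define n where "n = (if x2 = 0 then \<infinity> else ereal (y2 / x2))"
  have "has_tangent_slope x y t m"
    unfolding has_tangent_slope_def m_def using assms(3,4) det
    by (intro exI[of _ x1] exI[of _ y1]) auto
  moreover have "has_tangent_slope x y \<tau> n"
    unfolding has_tangent_slope_def n_def using assms(5,6) det
    by (intro exI[of _ x2] exI[of _ y2]) auto
  moreover have "m \<noteq> n"
    using det by (auto simp: m_def n_def field_simps)
  ultimately show ?thesis
    unfolding self_intersection_point_def using assms(1,2) by metis
qed

lemma curve_x_has_real_derivative:
  "(curve_x R r p q has_real_derivative
     - (q * r * sin (q * t)) * cos (p * t) - (R + r * cos (q * t)) * p * sin (p * t)) (at t)"
  unfolding curve_x_def by (auto intro!: derivative_eq_intros simp: algebra_simps)

lemma curve_y_has_real_derivative: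
  "(curve_y R r p q has_real_derivative
     - (q * r * sin (q * t)) * sin (p * t) + (R + r * cos (q * t)) * p * cos (p * t)) (at t)"
  unfolding curve_y_def by (auto intro!: derivative_eq_intros simp: algebra_simps)

lemma sin_int_times_pi_div_nonzero:
  fixes a p :: int
  assumes "p \<noteq> 0" and "\<not> p dvd a"
  shows "sin (a * pi / p) \<noteq> 0"
proof
  assume "sin (a * pi / p) = 0"
  then obtain i :: int where "a * pi / p = i * pi"
    by (auto simp: sin_zero_iff_int2)
  then have "real_of_int a = i * p"
    using assms(1) by (simp add: field_simps)
  then have "a = i * p"
    by (metis of_int_eq_iff of_int_mult)
  with assms(2) show False by simp
qed

text \<open>
  Equal radius and angle with reversed radial velocity: in the moving radial/angular frame the
  velocities are \<open>(a, b)\<close> and \<open>(-a, b)\<close>, whose determinant \<open>2 a b\<close> is nonzero.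
\<close>
lemma curve_self_intersection_if_radial_velocity_reversed:
  fixes p q :: int and R r t \<tau> :: real
  assumes "p \<noteq> 0" "q \<noteq> 0" "r > 0" "R > r"
    and cos_q: "cos (q * \<tau>) = cos (q * t)" and sin_q: "sin (q * \<tau>) = - sin (q * t)"
    and cos_p: "cos (p * \<tau>) = cos (p * t)" and sin_p: "sin (p * \<tau>) = sin (p * t)"
    and "sin (q * t) \<noteq> 0"
  shows "self_intersection_point (curve_x R r p q) (curve_y R r p q)
           (curve_x R r p q t, curve_y R r p q t)"
proof (rule self_intersection_point_if_independent_velocities)
  show "curve_x R r p q t = curve_x R r p q \<tau>" "curve_y R r p q t = curve_y R r p q \<tau>"
    unfolding curve_x_def curve_y_def by (simp_all add: cos_q cos_p sin_p)
  define a where "a = - (q * r * sin (q * t))"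
  define b where "b = (R + r * cos (q * t)) * p"
  define c where "c = cos (p * t)"
  define s where "s = sin (p * t)"
  show "(curve_x R r p q has_real_derivative a * c - b * s) (at t)"
    using curve_x_has_real_derivative[of R r p q t] by (simp add: a_def b_def c_def s_def)
  show "(curve_y R r p q has_real_derivative a * s + b * c) (at t)"
    using curve_y_has_real_derivative[of R r p q t] by (simp add: a_def b_def c_def s_def)
  show "(curve_x R r p q has_real_derivative - a * c - b * s) (at \<tau>)"
    using curve_x_has_real_derivative[of R r p q \<tau>]
    by (simp add: a_def b_def c_def s_def cos_q sin_q cos_p sin_p)
  show "(curve_y R r p q has_real_derivative - a * s + b * c) (at \<tau>)"
    using curve_y_has_real_derivative[of R r p q \<tau>]
    by (simp add: a_def b_def c_def s_def cos_q sin_q cos_p sin_p)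
  have "r * cos (q * t) \<ge> r * (-1)"
    using \<open>r > 0\<close> by (intro mult_left_mono) auto
  then have "R + r * cos (q * t) > 0"
    using \<open>R > r\<close> by simp
  then have "a * b \<noteq> 0"
    using assms by (simp add: a_def b_def)
  moreover have "(a * c - b * s) * (- a * s + b * c) - (- a * c - b * s) * (a * s + b * c)
      = 2 * (a * b) * (s\<^sup>2 + c\<^sup>2)"
    by (simp add: algebra_simps power2_eq_square)
  moreover have "s\<^sup>2 + c\<^sup>2 = 1"
    by (simp add: s_def c_def)
  ultimately show "(a * c - b * s) * (- a * s + b * c) \<noteq> (- a * c - b * s) * (a * s + b * c)"
    by auto
qed

theorem theorem14p5:
  fixes p q k j :: int and R r :: real
  assumes "p \<ge> 2" and "q \<ge> 1" and "coprime p q"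
    and "R > r" and "r > 0"
    and "1 \<le> k" and "k \<le> p - 1" and "0 \<le> j" and "j \<le> q - 1"
  shows "self_intersection_point (curve_x R r p q) (curve_y R r p q)
           (curve_x R r p q (crossing_param p q k j), curve_y R r p q (crossing_param p q k j))"
proof -
  define t where "t = crossing_param p q k j"
  define \<tau> where "\<tau> = crossing_param p q (- k) j"
  define \<theta> where "\<theta> = (q * k) * pi / p"
  have q_t: "q * t = pi * j + \<theta>" and q_\<tau>: "q * \<tau> = pi * j - \<theta>" and p_t: "p * t = p * \<tau> + 2 * pi * k"
    using assms(1,2) by (simp_all add: t_def \<tau>_def crossing_param_def \<theta>_def field_simps)
  have sin_j: "sin (pi * j) = 0"
    by (simp add: sin_zero_iff_int2)
  have cos_j: "cos (pi * j) \<noteq> 0"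
    using sin_cos_squared_add[of "pi * j"] sin_j by auto
  have "\<not> p dvd q * k"
    using assms(1,3,6,7) zdvd_not_zless[of k p] by (simp add: coprime_dvd_mult_right_iff)
  then have "sin \<theta> \<noteq> 0"
    using sin_int_times_pi_div_nonzero[of p "q * k"] assms(1) by (simp add: \<theta>_def)
  then have "sin (q * t) \<noteq> 0"
    using cos_j sin_j by (simp add: q_t sin_add)
  moreover have "cos (q * \<tau>) = cos (q * t)" "sin (q * \<tau>) = - sin (q * t)"
    by (simp_all add: q_t q_\<tau> cos_add cos_diff sin_add sin_diff sin_j)
  moreover have "cos (p * \<tau>) = cos (p * t)" "sin (p * \<tau>) = sin (p * t)"
    by (simp_all add: p_t cos_add sin_add cos_int_2pin sin_int_2pin)
  ultimately show ?thesis
    unfolding t_def[symmetric]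
    using assms(1,2,4,5)
    by (intro curve_self_intersection_if_radial_velocity_reversed[of p q r R \<tau> t]) auto
qed

end
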